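(* Fix $i\in\{1,\dots,d\}$ and let $Q_i$ be a continuous semimartingale, with corresponding observed price $P_i(t)=S_i(t)+h_i(t,J_i(t))$, $J_i(t)=\int_0^tK_i(t,s)\,dQ_i(s)$. Suppose there exists a sequence of stopping times $\tau_n$ converging almost surely to $\tau=\inf\{t\ge0:P_i(t)=0\}$ and such that $$Q_i(\tau_n)=\sup_{t\le\tau_n}Q_i(t).$$ Then $\tau=\infty$ $\mathbb P$-a.s., and $(P_i(t);t\ge0)$ is a strictly positive process.
   Context: On a filtered probability space $(\Omega,\mathcal F,(\mathcal F(t))_{t\ge0},\mathbb P)$ satisfying the usual hypotheses, $S=(S_1,\dots,S_d)$, $d\ge2$, is a continuous semimartingale with strictly positive components. Impact assumptions. With $D=\{(t,s)\in[0,\infty)^2:t\ge s\}$, for each $i$: $h_i\in C^{1,2}([0,\infty)\times\mathbb R)$ is nondecreasing in the second argument, $h_i(t,x)\ge0$ if $x\ge0$, $h_i(t,x)\le0$ if $x\le0$, and $\partial_xh_i,\partial_{xx}h_i$ are bounded; $K_i:D\to(0,\infty)$ is $C^2$ with $\partial_tK_i(t,s)\le0$, $\partial_sK_i(t,s)\ge0$ for $0\le s\le t$ (derivatives in the first and second argument, respectively) and $\sup_{t\ge0}K_i(t,t)<\infty$. *)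

theory Defs
  imports "HOL-Probability.Probability"
begin

section \<open>Filtered probability spaces\<close>

text \<open>
  The filtration is indexed by \<open>[0, \<infinity>]\<close>, so that the library notion \<^const>\<open>stopping_time\<close> applied
  to functions with values in \<^typ>\<open>ennreal\<close> is that of a \<open>[0, \<infinity>]\<close>-valued stopping time: at index
  \<open>\<infinity>\<close> its condition is void. The last member \<open>F \<infinity>\<close> may be any sub-sigma-algebra containing all
  others. Processes are functions on \<^typ>\<open>real\<close> of which only the values at times \<open>t \<ge> 0\<close> matter.
\<close>

locale usual_filtered_space = prob_space M + complete_measure M + filtration "space M" F
  for M :: "'a measure" and F :: "ennreal \<Rightarrow> 'a measure" +
  assumes subalgebra_F: "\<And>t. subalgebra M (F t)"
    and null_sets_F0: "null_sets M \<subseteq> sets (F 0)"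
    and right_continuous: "\<And>t. t < \<infinity> \<Longrightarrow> sets (F t) = (\<Inter>s\<in>{t<..}. sets (F s))"

type_synonym 'a process = "real \<Rightarrow> 'a \<Rightarrow> real"

definition adapted :: "(ennreal \<Rightarrow> 'a measure) \<Rightarrow> 'a process \<Rightarrow> bool" where
  "adapted F X \<longleftrightarrow> (\<forall>t\<ge>0. X t \<in> borel_measurable (F (ennreal t)))"

definition continuous_paths :: "'a measure \<Rightarrow> 'a process \<Rightarrow> bool" where
  "continuous_paths M X \<longleftrightarrow> (AE \<omega> in M. continuous_on {0..} (\<lambda>t. X t \<omega>))"

definition stopped :: "'a process \<Rightarrow> ('a \<Rightarrow> ennreal) \<Rightarrow> 'a process" where
  "stopped X T t \<omega> = X (enn2real (min (ennreal t) (T \<omega>))) \<omega>"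


section \<open>Continuous semimartingales\<close>

definition martingale :: "'a measure \<Rightarrow> (ennreal \<Rightarrow> 'a measure) \<Rightarrow> 'a process \<Rightarrow> bool" where
  "martingale M F X \<longleftrightarrow> adapted F X \<and> (\<forall>t\<ge>0. integrable M (X t)) \<and>
     (\<forall>s t. 0 \<le> s \<longrightarrow> s \<le> t \<longrightarrow> (AE \<omega> in M. real_cond_exp M (F (ennreal s)) (X t) \<omega> = X s \<omega>))"

definition continuous_local_martingale ::
    "'a measure \<Rightarrow> (ennreal \<Rightarrow> 'a measure) \<Rightarrow> 'a process \<Rightarrow> bool" where
  "continuous_local_martingale M F X \<longleftrightarrow> adapted F X \<and> continuous_paths M X \<and>
     (\<exists>\<sigma> :: nat \<Rightarrow> 'a \<Rightarrow> ennreal. (\<forall>n. stopping_time F (\<sigma> n)) \<and>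
        (AE \<omega> in M. incseq (\<lambda>n. \<sigma> n \<omega>) \<and> (\<lambda>n. \<sigma> n \<omega>) \<longlonglongrightarrow> \<infinity>) \<and>
        (\<forall>n. martingale M F (\<lambda>t \<omega>. stopped X (\<sigma> n) t \<omega> - X 0 \<omega>)))"

definition finite_variation_on :: "real set \<Rightarrow> (real \<Rightarrow> real) \<Rightarrow> bool" where
  "finite_variation_on I a \<longleftrightarrow>
     bdd_above {\<Sum>k<n. \<bar>a (x (Suc k)) - a (x k)\<bar> | (x :: nat \<Rightarrow> real) n. incseq x \<and> range x \<subseteq> I}"

definition continuous_finite_variation ::
    "'a measure \<Rightarrow> (ennreal \<Rightarrow> 'a measure) \<Rightarrow> 'a process \<Rightarrow> bool" where
  "continuous_finite_variation M F A \<longleftrightarrow> adapted F A \<and> continuous_paths M A \<and>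
     (AE \<omega> in M. \<forall>t\<ge>0. finite_variation_on {0..t} (\<lambda>s. A s \<omega>))"

definition continuous_semimartingale ::
    "'a measure \<Rightarrow> (ennreal \<Rightarrow> 'a measure) \<Rightarrow> 'a process \<Rightarrow> bool" where
  "continuous_semimartingale M F X \<longleftrightarrow> adapted F X \<and> continuous_paths M X \<and>
     (\<exists>L A. continuous_local_martingale M F L \<and> continuous_finite_variation M F A \<and>
        (AE \<omega> in M. \<forall>t\<ge>0. X t \<omega> = L t \<omega> + A t \<omega>))"


section \<open>The stochastic integral\<close>

text \<open>
  The integral of a left-continuous adapted integrand is defined following Protter
  (Stochastic Integration and Differential Equations, Chapter II): elementary on simple predictable
  processes \<open>\<Sum>k<m. \<xi> k * 1_(T k, T (k + 1)]\<close>, and extended by continuity from convergence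
  uniform on compacts in probability (of integrands) to convergence in probability (of integrals).
  The domain of integration is \<open>(0, t]\<close>.
\<close>

definition simple_predictable :: "'a measure \<Rightarrow> (ennreal \<Rightarrow> 'a measure) \<Rightarrow> nat \<Rightarrow>
    (nat \<Rightarrow> 'a \<Rightarrow> ennreal) \<Rightarrow> (nat \<Rightarrow> 'a \<Rightarrow> real) \<Rightarrow> bool" where
  "simple_predictable M F m T \<xi> \<longleftrightarrow>
     (\<forall>k\<le>m. stopping_time F (T k) \<and> (\<forall>\<omega>\<in>space M. T k \<omega> < \<infinity>)) \<and>
     (\<forall>k<m. (\<forall>\<omega>\<in>space M. T k \<omega> \<le> T (Suc k) \<omega>) \<and>
        \<xi> k \<in> borel_measurable (filtration.pre_sigma (space M) F (T k)))"

definition simple_process ::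
    "nat \<Rightarrow> (nat \<Rightarrow> 'a \<Rightarrow> ennreal) \<Rightarrow> (nat \<Rightarrow> 'a \<Rightarrow> real) \<Rightarrow> 'a process" where
  "simple_process m T \<xi> s \<omega> = (\<Sum>k<m. \<xi> k \<omega> * indicator {T k \<omega><..T (Suc k) \<omega>} (ennreal s))"

definition simple_integral :: "nat \<Rightarrow> (nat \<Rightarrow> 'a \<Rightarrow> ennreal) \<Rightarrow> (nat \<Rightarrow> 'a \<Rightarrow> real) \<Rightarrow>
    'a process \<Rightarrow> 'a process" where
  "simple_integral m T \<xi> X t \<omega> =
     (\<Sum>k<m. \<xi> k \<omega> * (stopped X (T (Suc k)) t \<omega> - stopped X (T k) t \<omega>))"

definition caglad_adapted ::
    "'a measure \<Rightarrow> (ennreal \<Rightarrow> 'a measure) \<Rightarrow> real \<Rightarrow> 'a process \<Rightarrow> bool" where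
  "caglad_adapted M F t H \<longleftrightarrow>
     (\<forall>s\<in>{0..t}. H s \<in> borel_measurable (F (ennreal s))) \<and>
     (AE \<omega> in M. (\<forall>s\<in>{0<..t}. ((\<lambda>r. H r \<omega>) \<longlongrightarrow> H s \<omega>) (at_left s)) \<and>
        (\<forall>s\<in>{0..<t}. \<exists>l. ((\<lambda>r. H r \<omega>) \<longlongrightarrow> l) (at_right s)))"

text \<open>
  \<open>has_stochastic_integral M F H X t I\<close>: the random variable \<open>I\<close> is a version of the integral of
  \<open>H\<close> against \<open>X\<close> over \<open>(0, t]\<close>. For a semimartingale \<open>X\<close> and a caglad adapted \<open>H\<close> such an \<open>I\<close>
  exists and is almost surely unique.
\<close>

definition has_stochastic_integral :: "'a measure \<Rightarrow> (ennreal \<Rightarrow> 'a measure) \<Rightarrow>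
    'a process \<Rightarrow> 'a process \<Rightarrow> real \<Rightarrow> ('a \<Rightarrow> real) \<Rightarrow> bool" where
  "has_stochastic_integral M F H X t I \<longleftrightarrow>
     caglad_adapted M F t H \<and> I \<in> borel_measurable (F (ennreal t)) \<and>
     (\<forall>m T \<xi>. (\<forall>n :: nat. simple_predictable M F (m n) (T n) (\<xi> n)) \<longrightarrow>
        (\<forall>\<epsilon>>0. (\<lambda>n. measure M {\<omega> \<in> space M.
            \<exists>s\<in>{0<..t}. \<epsilon> < \<bar>simple_process (m n) (T n) (\<xi> n) s \<omega> - H s \<omega>\<bar>}) \<longlonglongrightarrow> 0) \<longrightarrow>
        (\<forall>\<epsilon>>0. (\<lambda>n. measure M {\<omega> \<in> space M.
            \<epsilon> < \<bar>simple_integral (m n) (T n) (\<xi> n) X t \<omega> - I \<omega>\<bar>}) \<longlonglongrightarrow> 0))"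

text \<open>
  Stochastic integrals are determined only almost surely for each fixed \<open>t\<close>;
  \<open>J(t) = \<integral>\<^sub>0\<^sup>t K(t,s) dQ(s)\<close> as a process is taken in its continuous version, which is unique up to
  indistinguishability.
\<close>

definition volterra_integral :: "'a measure \<Rightarrow> (ennreal \<Rightarrow> 'a measure) \<Rightarrow>
    (real \<Rightarrow> real \<Rightarrow> real) \<Rightarrow> 'a process \<Rightarrow> 'a process \<Rightarrow> bool" where
  "volterra_integral M F K Q J \<longleftrightarrow> continuous_paths M J \<and>
     (\<forall>t\<ge>0. has_stochastic_integral M F (\<lambda>s \<omega>. K t s) Q t (J t))"


section \<open>Impact functions and kernels\<close>

text \<open>
  \<open>h\<close> is of class \<open>C\<^sup>1\<^sup>,\<^sup>2\<close> on \<open>[0, \<infinity>) \<times> \<real>\<close>, with partial derivatives \<open>ht\<close>, \<open>hx\<close>, \<open>hxx\<close>; the time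
  derivative at \<open>t = 0\<close> is one-sided.
\<close>

definition C12_with ::
    "(real \<Rightarrow> real \<Rightarrow> real) \<Rightarrow> (real \<Rightarrow> real \<Rightarrow> real) \<Rightarrow> (real \<Rightarrow> real \<Rightarrow> real) \<Rightarrow>
     (real \<Rightarrow> real \<Rightarrow> real) \<Rightarrow> bool" where
  "C12_with h ht hx hxx \<longleftrightarrow>
     (\<forall>g\<in>{h, ht, hx, hxx}. continuous_on ({0..} \<times> UNIV) (\<lambda>(t, x). g t x)) \<and>
     (\<forall>t\<ge>0. \<forall>x. ((\<lambda>r. h r x) has_real_derivative ht t x) (at t within {0..}) \<and>
        ((\<lambda>y. h t y) has_real_derivative hx t x) (at x) \<and>
        ((\<lambda>y. hx t y) has_real_derivative hxx t x) (at x))"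

definition impact_function :: "(real \<Rightarrow> real \<Rightarrow> real) \<Rightarrow> bool" where
  "impact_function h \<longleftrightarrow>
     (\<exists>ht hx hxx. C12_with h ht hx hxx \<and>
        bounded ((\<lambda>(t, x). hx t x) ` ({0..} \<times> UNIV)) \<and>
        bounded ((\<lambda>(t, x). hxx t x) ` ({0..} \<times> UNIV))) \<and>
     (\<forall>t\<ge>0. mono (h t)) \<and>
     (\<forall>t\<ge>0. \<forall>x. (0 \<le> x \<longrightarrow> 0 \<le> h t x) \<and> (x \<le> 0 \<longrightarrow> h t x \<le> 0))"

definition kernel_domain :: "(real \<times> real) set" where
  "kernel_domain = {(t, s). 0 \<le> s \<and> s \<le> t}"

text \<open>
  Differentiability on the closed set \<open>D\<close> is Frechet differentiability within \<open>D\<close>. Since \<open>D\<close> is convex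
  with nonempty interior, derivatives within \<open>D\<close> are unique, also at boundary points.
\<close>

definition C1_with :: "(real \<times> real) set \<Rightarrow> (real \<Rightarrow> real \<Rightarrow> real) \<Rightarrow>
    (real \<Rightarrow> real \<Rightarrow> real) \<Rightarrow> (real \<Rightarrow> real \<Rightarrow> real) \<Rightarrow> bool" where
  "C1_with D g gt gs \<longleftrightarrow>
     continuous_on D (\<lambda>(t, s). gt t s) \<and> continuous_on D (\<lambda>(t, s). gs t s) \<and>
     (\<forall>(t, s)\<in>D. ((\<lambda>(t', s'). g t' s') has_derivative (\<lambda>(u, v). gt t s * u + gs t s * v))
        (at (t, s) within D))"

definition impact_kernel :: "(real \<Rightarrow> real \<Rightarrow> real) \<Rightarrow> bool" where
  "impact_kernel K \<longleftrightarrow>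
     (\<forall>(t, s)\<in>kernel_domain. 0 < K t s) \<and>
     (\<exists>Kt Ks Ktt Kts Kst Kss.
        C1_with kernel_domain K Kt Ks \<and>
        C1_with kernel_domain Kt Ktt Kts \<and>
        C1_with kernel_domain Ks Kst Kss \<and>
        (\<forall>(t, s)\<in>kernel_domain. Kt t s \<le> 0 \<and> 0 \<le> Ks t s)) \<and>
     bdd_above ((\<lambda>t. K t t) ` {0..})"

end

(* For fixed t, the integral J(t) is a limit in probability of Riemann-Stieltjes sums over a grid,
   and K(t,.) is nondecreasing and positive. Summation by parts of these sums gives almost surely
   J(t) >= K(t,t) (Q(t) - c) + K(t,0) (c - Q(0)) whenever Q <= c on [0,t]. This extends by continuity
   from rational t to J(t) >= K(t,0) (Q(t) - Q(0)) >= 0 at every time t at which Q attains its running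
   maximum, in particular at T_n. If tau is finite then J(tau) >= 0 in the limit, so
   P(tau) >= S(tau) > 0, contradicting P(tau) = 0. As P(0) > 0, positivity follows. *)
theory Submission
  imports Defs
begin

section \<open>Summation by parts for monotone weights\<close>

text \<open>The right side exceeds the left by exactly the sum over \<open>j < n\<close> of
  \<open>(k (Suc j) - k j) * (c - q (Suc j))\<close>, and each of these products is nonnegative. The
  induction adds one product per step.\<close>

lemma abel_sum_lower_bound:
  fixes k q :: "nat \<Rightarrow> real"
  assumes "\<And>j. j < n \<Longrightarrow> k j \<le> k (Suc j)" and "\<And>j. j \<le> n \<Longrightarrow> q j \<le> c"
  shows "k n * (q n - c) + k 0 * (c - q 0) \<le> (\<Sum>j<n. k j * (q (Suc j) - q j))"
  using assms
proof (induction n)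
  case 0
  then show ?case by (simp add: algebra_simps)
next
  case (Suc n)
  have "0 \<le> (k (Suc n) - k n) * (c - q (Suc n))"
    using Suc.prems by simp
  moreover have "k n * (q n - c) + k 0 * (c - q 0) \<le> (\<Sum>j<n. k j * (q (Suc j) - q j))"
    using Suc by simp
  ultimately show ?case by (simp add: algebra_simps)
qed

section \<open>Approximation of a deterministic integrand on uniform grids\<close>

text \<open>The \<open>n\<close> half-open cells of the grid partition \<open>(0, t]\<close>, so a
  single summand survives at \<open>s\<close>. It carries the value of \<open>f\<close> at the left
  endpoint \<open>r\<close> of the cell of \<open>s\<close>, at most one mesh width away.\<close>

lemma simple_process_grid:
  fixes f :: "real \<Rightarrow> real"
  assumes "s \<in> {0<..t}" and "0 < n"
  obtains r where "r \<in> {0..t}" and "\<bar>r - s\<bar> \<le> t / real n"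
    and "simple_process n (\<lambda>k _. ennreal (t * real k / real n)) (\<lambda>k _. f (t * real k / real n)) s \<omega> = f r"
proof -
  have t: "0 < t" and s: "0 < s" "s \<le> t" using assms by auto
  \<comment> \<open>Cells are open on the left and closed on the right, so a grid point belongs to
    the cell that it ends; hence the ceiling minus one rather than the floor. As
    \<open>0 < s\<close>, the ceiling is at least 1 and the subtraction does not truncate.\<close>
  define k where "k = nat \<lceil>s * real n / t\<rceil> - 1"
  have pos: "0 < s * real n / t" using s t assms by simp
  then have "1 \<le> \<lceil>s * real n / t\<rceil>" by linarith
  then have k: "int k = \<lceil>s * real n / t\<rceil> - 1" unfolding k_def by linarith
  have k1: "real k < s * real n / t" and k2: "s * real n / t \<le> real k + 1"
    using k by linarith+
  have "s * real n / t \<le> real n"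
    using s t mult_right_mono[of s t "real n"] by (simp add: field_simps)
  then have "k < n" using k1 by linarith
  have iff: "s \<in> {t * real j / real n<..t * real (Suc j) / real n} \<longleftrightarrow> j = k" for j
  proof -
    have "s \<in> {t * real j / real n<..t * real (Suc j) / real n} \<longleftrightarrow>
        real j < s * real n / t \<and> s * real n / t \<le> real j + 1"
      using t assms(2) by (simp add: field_simps)
    also have "\<dots> \<longleftrightarrow> j = k" using k1 k2 by auto
    finally show ?thesis .
  qed
  have ind: "indicator {ennreal (t * real j / real n)<..ennreal (t * real (Suc j) / real n)} (ennreal s)
      = (if j = k then 1 else 0 :: real)" for j
    using iff[of j] t s by (auto simp: indicator_def ennreal_less_iff ennreal_le_iff2)
  show ?thesis
  proof (rule that)
    show "t * real k / real n \<in> {0..t}" using t \<open>k < n\<close> by (simp add: field_simps)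
    show "\<bar>t * real k / real n - s\<bar> \<le> t / real n"
      using iff[of k] by (auto simp: algebra_simps add_divide_distrib abs_if)
    show "simple_process n (\<lambda>k _. ennreal (t * real k / real n)) (\<lambda>k _. f (t * real k / real n)) s \<omega>
      = f (t * real k / real n)"
      unfolding simple_process_def ind using \<open>k < n\<close> by (simp add: if_distrib cong: if_cong)
  qed
qed

text \<open>Uniform continuity on the compact interval gives one mesh size for all \<open>s\<close>,
  and for all \<omega> at once because the integrand is deterministic. Using \<open>Suc n\<close>
  cells keeps every grid nonempty.\<close>

lemma simple_process_grid_uniform:
  fixes f :: "real \<Rightarrow> real"
  assumes "continuous_on {0..t} f" and "0 < \<epsilon>"
  shows "\<forall>\<^sub>F n in sequentially. \<forall>\<omega>::'a. \<forall>s\<in>{0<..t}.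
    \<bar>simple_process (Suc n) (\<lambda>k _. ennreal (t * real k / real (Suc n)))
        (\<lambda>k _. f (t * real k / real (Suc n))) s \<omega> - f s\<bar> \<le> \<epsilon>"
proof -
  have "uniformly_continuous_on {0..t} f"
    using assms(1) compact_uniformly_continuous by blast
  then obtain \<delta> where \<delta>: "0 < \<delta>"
    "\<And>r s. r \<in> {0..t} \<Longrightarrow> s \<in> {0..t} \<Longrightarrow> \<bar>r - s\<bar> < \<delta> \<Longrightarrow> \<bar>f r - f s\<bar> < \<epsilon>"
    using \<open>0 < \<epsilon>\<close> unfolding uniformly_continuous_on_def dist_real_def by metis
  have "(\<lambda>n. t / real (Suc n)) \<longlonglongrightarrow> 0"
    using LIMSEQ_Suc[OF lim_const_over_n[of t]] by simp
  then have "\<forall>\<^sub>F n in sequentially. t / real (Suc n) < \<delta>"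
    using \<delta>(1) by (rule order_tendstoD)
  then show ?thesis
  proof eventually_elim
    case (elim n)
    show ?case
    proof (intro allI ballI)
      fix \<omega> :: 'a and s assume s: "s \<in> {0<..t}"
      obtain r where r: "r \<in> {0..t}" "\<bar>r - s\<bar> \<le> t / real (Suc n)"
        "simple_process (Suc n) (\<lambda>k _. ennreal (t * real k / real (Suc n)))
          (\<lambda>k _. f (t * real k / real (Suc n))) s \<omega> = f r"
        by (rule simple_process_grid[OF s zero_less_Suc])
      show "\<bar>simple_process (Suc n) (\<lambda>k _. ennreal (t * real k / real (Suc n)))
          (\<lambda>k _. f (t * real k / real (Suc n))) s \<omega> - f s\<bar> \<le> \<epsilon>"
        unfolding r(3) using \<delta>(2)[OF r(1), of s] r(2) elim s by fastforce
    qed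
  qed
qed

section \<open>Lower bound for integrals of monotone deterministic integrands\<close>

text \<open>
  The running supremum of \<open>Q\<close> enters only through its upper bounds \<open>c\<close>: one and the same \<open>c\<close> then
  serves a whole sequence of times, and no measurability of the supremum is needed.
\<close>

lemma (in usual_filtered_space) stochastic_integral_lower_bound:
  fixes f :: "real \<Rightarrow> real"
  assumes Q: "adapted F Q" and I: "has_stochastic_integral M F (\<lambda>s \<omega>. f s) Q t I"
    and "0 \<le> t" and f: "continuous_on {0..t} f" "mono_on {0..t} f"
  shows "AE \<omega> in M. \<forall>c. (\<forall>s\<in>{0..t}. Q s \<omega> \<le> c) \<longrightarrow>
    f t * (Q t \<omega> - c) + f 0 * (c - Q 0 \<omega>) \<le> I \<omega>"
proof -
  define x where "x n k = t * real k / real (Suc n)" for n k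
  define Z where "Z n = simple_integral (Suc n) (\<lambda>k _. ennreal (x n k)) (\<lambda>k _. f (x n k)) Q t" for n
  have x: "x n k \<in> {0..t}" if "k \<le> Suc n" for n k
  proof -
    have "t * real k \<le> t * real (Suc n)" using that \<open>0 \<le> t\<close> by (intro mult_left_mono) auto
    then show ?thesis using \<open>0 \<le> t\<close> unfolding x_def by (simp add: field_simps)
  qed
  have xmono: "x n k \<le> x n (Suc k)" for n k
    using \<open>0 \<le> t\<close> unfolding x_def by (intro divide_right_mono mult_left_mono) auto
  \<comment> \<open>No grid time exceeds \<open>t\<close>, so stopping changes nothing and
    \<open>Z n\<close> is the Riemann-Stieltjes sum of the path with left endpoints.\<close>
  have Z: "Z n \<omega> = (\<Sum>k<Suc n. f (x n k) * (Q (x n (Suc k)) \<omega> - Q (x n k) \<omega>))" for n \<omega>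
    unfolding Z_def simple_integral_def stopped_def
  proof (intro sum.cong refl)
    fix k assume "k \<in> {..<Suc n}"
    then have "min (ennreal t) (ennreal (x n k)) = ennreal (x n k)"
      "min (ennreal t) (ennreal (x n (Suc k))) = ennreal (x n (Suc k))"
      "0 \<le> x n k" "0 \<le> x n (Suc k)"
      using x[of k n] x[of "Suc k" n] by (auto simp: min_def ennreal_leI antisym)
    then show "f (x n k) * (Q (enn2real (min (ennreal t) (ennreal (x n (Suc k))))) \<omega> -
        Q (enn2real (min (ennreal t) (ennreal (x n k)))) \<omega>) =
      f (x n k) * (Q (x n (Suc k)) \<omega> - Q (x n k) \<omega>)"
      by simp
  qed
  have bound: "f t * (Q t \<omega> - c) + f 0 * (c - Q 0 \<omega>) \<le> Z n \<omega>"
    if "\<forall>s\<in>{0..t}. Q s \<omega> \<le> c" for n \<omega> c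
  proof -
    have "f (x n (Suc n)) * (Q (x n (Suc n)) \<omega> - c) + f (x n 0) * (c - Q (x n 0) \<omega>) \<le> Z n \<omega>"
      unfolding Z
    proof (rule abel_sum_lower_bound[of "Suc n" "\<lambda>k. f (x n k)" "\<lambda>k. Q (x n k) \<omega>"])
      show "f (x n j) \<le> f (x n (Suc j))" if "j < Suc n" for j
        using that by (intro mono_onD[OF f(2)] x xmono) auto
      show "Q (x n j) \<omega> \<le> c" if "j \<le> Suc n" for j
        using that x \<open>\<forall>s\<in>{0..t}. Q s \<omega> \<le> c\<close> by blast
    qed
    \<comment> \<open>Every grid starts at 0 and ends at \<open>t\<close>, so the boundary terms do
      not depend on \<open>n\<close>.\<close>
    then show ?thesis by (simp add: x_def)
  qed
  have Fmeas: "g \<in> borel_measurable M" if "g \<in> borel_measurable (F u)" for g :: "'a \<Rightarrow> real" and u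
    using measurable_from_subalg[OF subalgebra_F that] .
  have "I \<in> borel_measurable M"
    using I Fmeas unfolding has_stochastic_integral_def by blast
  moreover have "Q s \<in> borel_measurable M" if "0 \<le> s" for s
    using Q that Fmeas unfolding adapted_def by blast
  then have "Z n \<in> borel_measurable M" for n
    unfolding Z[abs_def] using x by (intro borel_measurable_sum borel_measurable_times
        borel_measurable_diff borel_measurable_const) auto
  ultimately have meas: "{\<omega> \<in> space M. \<epsilon> < \<bar>Z n \<omega> - I \<omega>\<bar>} \<in> sets M" for n \<epsilon>
    by measurable
  have conv: "(\<lambda>n. measure M {\<omega> \<in> space M. \<epsilon> < \<bar>Z n \<omega> - I \<omega>\<bar>}) \<longlonglongrightarrow> 0" if "0 < \<epsilon>" for \<epsilon>
  proof -
    have simple: "simple_predictable M F (Suc n) (\<lambda>k _. ennreal (x n k)) (\<lambda>k _. f (x n k))" for n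
      unfolding simple_predictable_def
      using xmono by (auto simp: ennreal_leI stopping_time_const)
    have approx: "(\<lambda>n. measure M {\<omega> \<in> space M. \<exists>s\<in>{0<..t}. \<delta> < \<bar>simple_process (Suc n)
        (\<lambda>k _. ennreal (x n k)) (\<lambda>k _. f (x n k)) s \<omega> - f s\<bar>}) \<longlonglongrightarrow> 0" if "0 < \<delta>" for \<delta>
    \<comment> \<open>By the uniform approximation these events are eventually empty, so their
      measures are eventually equal to 0.\<close>
    proof (rule tendsto_eventually)
      show "\<forall>\<^sub>F n in sequentially. measure M {\<omega> \<in> space M. \<exists>s\<in>{0<..t}. \<delta> < \<bar>simple_process (Suc n)
        (\<lambda>k _. ennreal (x n k)) (\<lambda>k _. f (x n k)) s \<omega> - f s\<bar>} = 0"
        using simple_process_grid_uniform[OF f(1) that, where ?'a = 'a] unfolding x_def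
      proof eventually_elim
        case (elim n)
        then show ?case by (simp add: not_less[symmetric] del: of_nat_Suc)
      qed
    qed
    have lim: "(\<lambda>n. measure M {\<omega> \<in> space M. \<epsilon> < \<bar>simple_integral (m n) (T n) (\<xi> n) Q t \<omega> - I \<omega>\<bar>})
        \<longlonglongrightarrow> 0"
      if "\<And>n. simple_predictable M F (m n) (T n) (\<xi> n)"
        and "\<And>\<delta>. 0 < \<delta> \<Longrightarrow> (\<lambda>n. measure M {\<omega> \<in> space M. \<exists>s\<in>{0<..t}.
          \<delta> < \<bar>simple_process (m n) (T n) (\<xi> n) s \<omega> - f s\<bar>}) \<longlonglongrightarrow> 0" for m T \<xi>
      using I that \<open>0 < \<epsilon>\<close> unfolding has_stochastic_integral_def by blast
    show ?thesis
      unfolding Z_def by (rule lim[of Suc, OF simple approx])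
  qed
  \<comment> \<open>Since \<open>bound\<close> holds for every \<open>n\<close>, it is enough that
    for almost every \<omega> some \<open>Z n\<close> comes close to \<open>I\<close>. The
    exceptional event \<open>N\<close> lies in each of the events of \<open>conv\<close>, whose
    probabilities tend to 0.\<close>
  have near: "AE \<omega> in M. \<exists>n. \<bar>Z n \<omega> - I \<omega>\<bar> \<le> \<epsilon>" if "0 < \<epsilon>" for \<epsilon>
  proof -
    define N where "N = (\<Inter>n. {\<omega> \<in> space M. \<epsilon> < \<bar>Z n \<omega> - I \<omega>\<bar>})"
    have "N \<in> sets M" unfolding N_def using meas by auto
    have "measure M N \<le> measure M {\<omega> \<in> space M. \<epsilon> < \<bar>Z n \<omega> - I \<omega>\<bar>}" for n
      by (rule finite_measure_mono) (use meas in \<open>auto simp: N_def\<close>)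
    then have "measure M N \<le> 0"
      using conv[OF that] by (intro LIMSEQ_le_const) auto
    then have "N \<in> null_sets M"
      using \<open>N \<in> sets M\<close> by (simp add: null_sets_def emeasure_eq_measure measure_le_0_iff)
    then show ?thesis
      by (rule AE_I') (auto simp: N_def not_le)
  qed
  have "AE \<omega> in M. \<forall>j. \<exists>n. \<bar>Z n \<omega> - I \<omega>\<bar> \<le> inverse (real (Suc j))"
    using near by (subst AE_all_countable) auto
  then show ?thesis
  proof eventually_elim
    case (elim \<omega>)
    show ?case
    proof (intro allI impI)
      fix c assume c: "\<forall>s\<in>{0..t}. Q s \<omega> \<le> c"
      show "f t * (Q t \<omega> - c) + f 0 * (c - Q 0 \<omega>) \<le> I \<omega>"
      proof (rule field_le_epsilon)
        fix e :: real assume "0 < e"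
        then obtain j where "inverse (real (Suc j)) < e" using reals_Archimedean by blast
        moreover obtain n where "\<bar>Z n \<omega> - I \<omega>\<bar> \<le> inverse (real (Suc j))" using elim by blast
        ultimately show "f t * (Q t \<omega> - c) + f 0 * (c - Q 0 \<omega>) \<le> I \<omega> + e"
          using bound[OF c, of n] by linarith
      qed
    qed
  qed
qed

section \<open>Continuity and monotonicity of the kernel\<close>

lemma impact_kernel_continuous_on:
  assumes "impact_kernel K"
  shows "continuous_on kernel_domain (\<lambda>(t, s). K t s)"
proof -
  obtain Kt Ks where "C1_with kernel_domain K Kt Ks"
    using assms unfolding impact_kernel_def by blast
  then have "(\<lambda>(t, s). K t s) differentiable_on kernel_domain"
    unfolding C1_with_def differentiable_on_def differentiable_def by fast
  then show ?thesis by (rule differentiable_imp_continuous_on)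
qed

lemma continuous_on_impact_kernel [continuous_intros]:
  assumes "impact_kernel K" and "continuous_on A u" and "continuous_on A v"
    and "\<And>a. a \<in> A \<Longrightarrow> 0 \<le> v a \<and> v a \<le> u a"
  shows "continuous_on A (\<lambda>a. K (u a) (v a))"
proof -
  have "continuous_on A (\<lambda>a. (\<lambda>(t, s). K t s) (u a, v a))"
    by (rule continuous_on_compose2[OF impact_kernel_continuous_on[OF assms(1)]])
      (use assms in \<open>auto simp: kernel_domain_def intro!: continuous_on_Pair\<close>)
  then show ?thesis by simp
qed

text \<open>Composing the derivative within the domain with the segment \<open>r\<close> to
  \<open>(t, r)\<close> yields the partial derivative \<open>Ks t s\<close>. For
  \<open>0 < s < t\<close> it is an ordinary two-sided derivative; continuity of \<open>K t\<close>
  takes care of the endpoints.\<close>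

lemma impact_kernel_mono_on:
  assumes "impact_kernel K"
  shows "mono_on {0..t} (K t)"
proof (rule mono_onI)
  fix a b assume ab: "a \<in> {0..t}" "b \<in> {0..t}" "a \<le> b"
  obtain Kt Ks where "C1_with kernel_domain K Kt Ks"
    and Ks: "\<forall>(t, s)\<in>kernel_domain. 0 \<le> Ks t s"
    using assms unfolding impact_kernel_def by blast
  then have D: "((\<lambda>(t', s'). K t' s') has_derivative (\<lambda>(u, v). Kt t s * u + Ks t s * v))
      (at (t, s) within kernel_domain)" if "(t, s) \<in> kernel_domain" for t s
    using that unfolding C1_with_def by blast
  have "(K t has_real_derivative Ks t s) (at s)" if s: "a < s" "s < b" for s
  proof -
    have dom: "Pair t ` {0<..<t} \<subseteq> kernel_domain" "(t, s) \<in> kernel_domain" and s': "s \<in> {0<..<t}"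
      using ab s by (auto simp: kernel_domain_def)
    have "((\<lambda>r. (\<lambda>(t', s'). K t' s') (t, r)) has_derivative
        (\<lambda>v. (\<lambda>(u, v). Kt t s * u + Ks t s * v) (0, v))) (at s within {0<..<t})"
      by (rule has_derivative_in_compose[where f = "Pair t", OF _ has_derivative_subset[OF D[OF dom(2)] dom(1)]])
        (auto intro!: derivative_eq_intros)
    then have "(K t has_derivative (*) (Ks t s)) (at s within {0<..<t})"
      by simp
    then show ?thesis
      unfolding has_field_derivative_def at_within_open[OF s' open_greaterThanLessThan] .
  qed
  moreover have "0 \<le> Ks t s" if "a < s" "s < b" for s
    using Ks ab that by (auto simp: kernel_domain_def)
  moreover have "continuous_on {a..b} (K t)"
    by (rule continuous_on_impact_kernel[OF assms]) (use ab in \<open>auto intro: continuous_on_id continuous_on_const\<close>)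
  ultimately show "K t a \<le> K t b"
    using DERIV_nonneg_imp_increasing_open[OF ab(3), of "K t"] by blast
qed

section \<open>Strict positivity of the observed price\<close>

theorem proposition2p5:
  fixes M :: "'a measure" and F :: "ennreal \<Rightarrow> 'a measure"
    and d i :: nat
    and S :: "nat \<Rightarrow> real \<Rightarrow> 'a \<Rightarrow> real"
    and h K :: "nat \<Rightarrow> real \<Rightarrow> real \<Rightarrow> real"
    and Q J P :: "real \<Rightarrow> 'a \<Rightarrow> real"
    and T :: "nat \<Rightarrow> 'a \<Rightarrow> ennreal" and \<tau> :: "'a \<Rightarrow> ennreal"
  assumes "usual_filtered_space M F"
    and "2 \<le> d"
    and "\<And>j. j \<in> {1..d} \<Longrightarrow> continuous_semimartingale M F (S j)"
    and "\<And>j. j \<in> {1..d} \<Longrightarrow> AE \<omega> in M. \<forall>t\<ge>0. 0 < S j t \<omega>"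
    and "\<And>j. j \<in> {1..d} \<Longrightarrow> impact_function (h j)"
    and "\<And>j. j \<in> {1..d} \<Longrightarrow> impact_kernel (K j)"
    and "i \<in> {1..d}"
    and "continuous_semimartingale M F Q"
    and "volterra_integral M F (K i) Q J"
    and P: "P = (\<lambda>t \<omega>. S i t \<omega> + h i t (J t \<omega>))"
    and tau: "\<tau> = (\<lambda>\<omega>. Inf {ennreal t | t. 0 \<le> t \<and> P t \<omega> = 0})"
    and "\<And>n. stopping_time F (T n)"
    and "AE \<omega> in M. (\<lambda>n. T n \<omega>) \<longlonglongrightarrow> \<tau> \<omega>"
    and "\<And>n. AE \<omega> in M. T n \<omega> < \<infinity> \<longrightarrow>
           Q (enn2real (T n \<omega>)) \<omega> = (SUP t\<in>{0..enn2real (T n \<omega>)}. Q t \<omega>)"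
  shows "(AE \<omega> in M. \<tau> \<omega> = \<infinity>) \<and> (AE \<omega> in M. \<forall>t\<ge>0. 0 < P t \<omega>)"
proof -
  interpret usual_filtered_space M F by fact
  have K: "impact_kernel (K i)" and h: "impact_function (h i)"
    and Scont: "continuous_paths M (S i)" and Spos: "AE \<omega> in M. \<forall>t\<ge>0. 0 < S i t \<omega>"
    using assms(3-7) by (auto simp: continuous_semimartingale_def)
  have Qad: "adapted F Q" and Qcont: "continuous_paths M Q"
    using assms(8) by (auto simp: continuous_semimartingale_def)
  have Jcont: "continuous_paths M J"
    and J: "\<And>t. 0 \<le> t \<Longrightarrow> has_stochastic_integral M F (\<lambda>s \<omega>. K i t s) Q t (J t)"
    using assms(9) by (auto simp: volterra_integral_def)
  have lower: "AE \<omega> in M. \<forall>c. (\<forall>s\<in>{0..t}. Q s \<omega> \<le> c) \<longrightarrow>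
      K i t t * (Q t \<omega> - c) + K i t 0 * (c - Q 0 \<omega>) \<le> J t \<omega>" if "0 \<le> t" for t
  proof (rule stochastic_integral_lower_bound[OF Qad J[OF that] that _ impact_kernel_mono_on[OF K]])
    show "continuous_on {0..t} (K i t)"
      by (rule continuous_on_impact_kernel[OF K]) (auto intro: continuous_on_id continuous_on_const)
  qed
  \<comment> \<open>The null set of \<open>lower\<close> depends on \<open>t\<close>, so a common
    one is formed over the rational times only. The quantifier over \<open>c\<close> stays inside
    it, so \<open>c\<close> may later be the random value of \<open>Q\<close> at an arbitrary real
    time.\<close>
  have "AE \<omega> in M. \<forall>r::rat. 0 \<le> r \<longrightarrow> (\<forall>c. (\<forall>s\<in>{0..of_rat r}. Q s \<omega> \<le> c) \<longrightarrow>
      K i (of_rat r) (of_rat r) * (Q (of_rat r) \<omega> - c) + K i (of_rat r) 0 * (c - Q 0 \<omega>)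
        \<le> J (of_rat r) \<omega>)"
    using lower by (subst AE_all_countable) auto
  moreover have "AE \<omega> in M. \<forall>n. T n \<omega> < \<infinity> \<longrightarrow>
      Q (enn2real (T n \<omega>)) \<omega> = (SUP t\<in>{0..enn2real (T n \<omega>)}. Q t \<omega>)"
    using assms(14) by (subst AE_all_countable) auto
  moreover note assms(13) Spos Scont[unfolded continuous_paths_def]
    Qcont[unfolded continuous_paths_def] Jcont[unfolded continuous_paths_def]
  ultimately have "AE \<omega> in M. \<tau> \<omega> = \<infinity> \<and> (\<forall>t\<ge>0. 0 < P t \<omega>)"
  proof eventually_elim
    case (elim \<omega>)
    note Qc = \<open>continuous_on {0..} (\<lambda>t. Q t \<omega>)\<close> and Jc = \<open>continuous_on {0..} (\<lambda>t. J t \<omega>)\<close>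
      and Sc = \<open>continuous_on {0..} (\<lambda>t. S i t \<omega>)\<close>
    note Tmax = elim(2)
    \<comment> \<open>Rational times approach \<open>t\<close> from the left, where \<open>Q t \<omega>\<close> still bounds the path.\<close>
    have J_nonneg: "0 \<le> J t \<omega>" if "0 \<le> t" and max: "\<forall>s\<in>{0..t}. Q s \<omega> \<le> Q t \<omega>" for t
    proof (cases "t = 0")
      case True
      then show ?thesis using elim(1)[rule_format, of 0 "Q 0 \<omega>"] by simp
    next
      case False
      then have "0 < t" using that by simp
      have "\<exists>r::rat. max 0 (t - inverse (real (Suc n))) < of_rat r \<and> of_rat r < t" for n
        using \<open>0 < t\<close> of_rat_dense[of "max 0 (t - inverse (real (Suc n)))" t] by auto
      then obtain r :: "nat \<Rightarrow> rat" where
        r: "\<And>n. max 0 (t - inverse (real (Suc n))) < of_rat (r n)" "\<And>n. of_rat (r n) < t"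
        by metis
      have r0: "0 \<le> r n" "0 \<le> (of_rat (r n) :: real)" for n
      proof -
        show "0 \<le> (of_rat (r n) :: real)" using r(1)[of n] by simp
        then show "0 \<le> r n" by simp
      qed
      have lim: "(\<lambda>n. of_rat (r n)) \<longlonglongrightarrow> t"
      proof (rule tendsto_sandwich)
        show "(\<lambda>n. t - inverse (real (Suc n))) \<longlonglongrightarrow> t"
          using tendsto_diff[OF tendsto_const LIMSEQ_inverse_real_of_nat, of t] by simp
        show "\<forall>\<^sub>F n in sequentially. t - inverse (real (Suc n)) \<le> of_rat (r n)"
          using r(1) by (intro always_eventually allI) (simp add: less_imp_le)
        show "\<forall>\<^sub>F n in sequentially. of_rat (r n) \<le> t"
          using r(2) by (intro always_eventually allI) (simp add: less_imp_le)
      qed auto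
      have seq: "(\<lambda>n. g (of_rat (r n))) \<longlonglongrightarrow> g t" if "continuous_on {0..} g" for g :: "real \<Rightarrow> real"
        using continuous_on_tendsto_compose[OF that lim] r0 \<open>0 < t\<close> by simp
      have "continuous_on {0..} (\<lambda>u. K i u u)" "continuous_on {0..} (\<lambda>u. K i u 0)"
        by (auto intro!: continuous_on_impact_kernel[OF K] continuous_on_id continuous_on_const)
      then have "(\<lambda>n. K i (of_rat (r n)) (of_rat (r n)) * (Q (of_rat (r n)) \<omega> - Q t \<omega>)
          + K i (of_rat (r n)) 0 * (Q t \<omega> - Q 0 \<omega>))
        \<longlonglongrightarrow> K i t t * (Q t \<omega> - Q t \<omega>) + K i t 0 * (Q t \<omega> - Q 0 \<omega>)"
        using seq[OF Qc] by (intro tendsto_intros seq[of "\<lambda>u. K i u u"] seq[of "\<lambda>u. K i u 0"]) auto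
      moreover have "K i (of_rat (r n)) (of_rat (r n)) * (Q (of_rat (r n)) \<omega> - Q t \<omega>)
          + K i (of_rat (r n)) 0 * (Q t \<omega> - Q 0 \<omega>) \<le> J (of_rat (r n)) \<omega>" for n
        using elim(1)[rule_format, OF r0(1)] max r(2)[of n] by fastforce
      \<comment> \<open>The first term vanishes because \<open>c\<close> is now the value of the
        path at \<open>t\<close> itself; what remains is \<open>K i t 0\<close> times the rise of
        the path since time 0.\<close>
      ultimately have "K i t t * (Q t \<omega> - Q t \<omega>) + K i t 0 * (Q t \<omega> - Q 0 \<omega>) \<le> J t \<omega>"
        using seq[OF Jc] by (intro LIMSEQ_le) auto
      moreover have "0 < K i t 0"
        using K \<open>0 < t\<close> unfolding impact_kernel_def kernel_domain_def by auto
      then have "0 \<le> K i t 0 * (Q t \<omega> - Q 0 \<omega>)"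
        using max \<open>0 < t\<close> by simp
      ultimately show ?thesis by simp
    qed
    have P_pos: "0 < P t \<omega>" if "0 \<le> t" "0 \<le> J t \<omega>" for t
      using that elim(4) h unfolding P impact_function_def by (smt (verit))
    have Pc: "continuous_on {0..} (\<lambda>t. P t \<omega>)"
    proof -
      have "continuous_on ({0..} \<times> UNIV) (\<lambda>(t, x). h i t x)"
        using h unfolding impact_function_def C12_with_def by blast
      then have "continuous_on {0..} (\<lambda>t. (\<lambda>(t, x). h i t x) (t, J t \<omega>))"
        by (rule continuous_on_compose2) (auto intro!: continuous_on_Pair continuous_on_id Jc)
      then show ?thesis unfolding P using Sc by (auto intro: continuous_on_add)
    qed
    have no_zero: "P t \<omega> \<noteq> 0" if "0 \<le> t" for t
    proof
      assume "P t \<omega> = 0"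
      \<comment> \<open>Continuity of the path makes the zero set closed, so its infimum is
        attained: \<tau> is finite and \<open>P\<close> vanishes at \<tau> itself.\<close>
      define A where "A = {t. 0 \<le> t \<and> P t \<omega> = 0}"
      have "A \<noteq> {}" "bdd_below A" using \<open>P t \<omega> = 0\<close> that by (auto simp: A_def intro: bdd_belowI)
      moreover have "closed A"
        using continuous_closed_preimage_constant[OF Pc, of 0] by (simp add: A_def)
      ultimately have "Inf A \<in> A" by (intro closed_contains_Inf)
      then have z: "0 \<le> Inf A" "P (Inf A) \<omega> = 0" by (auto simp: A_def)
      have tau_eq: "\<tau> \<omega> = ennreal (Inf A)"
        unfolding tau
      proof (rule Inf_eqI)
        show "ennreal (Inf A) \<le> y" if "y \<in> {ennreal t |t. 0 \<le> t \<and> P t \<omega> = 0}" for y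
          using that \<open>bdd_below A\<close> by (auto simp: A_def intro!: ennreal_leI cInf_lower)
        show "y \<le> ennreal (Inf A)" if "\<And>u. u \<in> {ennreal t |t. 0 \<le> t \<and> P t \<omega> = 0} \<Longrightarrow> y \<le> u" for y
          using that z by blast
      qed
      \<comment> \<open>The maximum property is available only where \<open>T n\<close> is finite,
        and \<open>enn2real\<close> would send an infinite value to 0. A finite limit excludes this
        for all large \<open>n\<close>.\<close>
      have fin: "\<forall>\<^sub>F n in sequentially. T n \<omega> < \<infinity>"
        using elim(3) by (rule order_tendstoD) (simp add: tau_eq)
      have lim: "(\<lambda>n. enn2real (T n \<omega>)) \<longlonglongrightarrow> Inf A"
        using elim(3) z(1) by (intro tendsto_enn2real) (simp_all add: tau_eq)
      have "(\<lambda>n. J (enn2real (T n \<omega>)) \<omega>) \<longlonglongrightarrow> J (Inf A) \<omega>"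
        using continuous_on_tendsto_compose[OF Jc lim] z(1) by simp
      moreover have "\<forall>\<^sub>F n in sequentially. 0 \<le> J (enn2real (T n \<omega>)) \<omega>"
        using fin
      proof eventually_elim
        case (elim n)
        define u where "u = enn2real (T n \<omega>)"
        have "continuous_on {0..u} (\<lambda>t. Q t \<omega>)"
          using Qc by (rule continuous_on_subset) auto
        \<comment> \<open>Boundedness of the path makes the real-valued \<open>SUP\<close> a genuine
          upper bound rather than an unspecified value.\<close>
        then have "bdd_above ((\<lambda>t. Q t \<omega>) ` {0..u})"
          by (intro bounded_imp_bdd_above compact_imp_bounded compact_continuous_image) auto
        moreover have "Q u \<omega> = (SUP t\<in>{0..u}. Q t \<omega>)"
          using Tmax elim unfolding u_def by blast
        ultimately have "\<forall>s\<in>{0..u}. Q s \<omega> \<le> Q u \<omega>"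
          by (metis cSUP_upper)
        then show ?case
          using J_nonneg[of u] by (simp add: u_def)
      qed
      ultimately have "0 \<le> J (Inf A) \<omega>"
        by (rule tendsto_lowerbound) simp
      then show False using P_pos[OF z(1)] z(2) by simp
    qed
    have "0 < P t \<omega>" if "0 \<le> t" for t
    proof (rule ccontr)
      assume "\<not> 0 < P t \<omega>"
      \<comment> \<open>Time 0 is trivially a maximum of the path over \<open>{0..0}\<close>. A
        nonpositive value at \<open>t\<close> would then force a zero in between.\<close>
      moreover have "0 < P 0 \<omega>" using P_pos[of 0] J_nonneg[of 0] by simp
      moreover have "continuous_on {0..t} (\<lambda>t. P t \<omega>)"
        using Pc by (rule continuous_on_subset) auto
      ultimately obtain s where "0 \<le> s" "P s \<omega> = 0"
        using IVT2'[of "\<lambda>t. P t \<omega>" t 0 0] \<open>0 \<le> t\<close> by auto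
      then show False using no_zero by blast
    qed
    moreover have "\<tau> \<omega> = \<infinity>"
    proof -
      \<comment> \<open>Without zeros, \<tau> is the infimum of the empty set, which in
        \<open>ennreal\<close> is the top element.\<close>
      have "{ennreal t |t. 0 \<le> t \<and> P t \<omega> = 0} = {}" using no_zero by auto
      then show ?thesis unfolding tau by (simp only: Inf_empty infinity_ennreal_def)
    qed
    ultimately show ?case by blast
  qed
  then show ?thesis by auto
qed

end
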